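(* For every $n\ge 4$, the number of smooth arithmetical structures on $D_n$ satisfies \[ \frac{1}{24}(n^3-3n^2-n-45)\leq \lvert\operatorname{SArith}(D_n)\rvert<\frac{2}{3}n^3-2n^2+\frac{16}{3}n-6+(2n^2-4n+2)\log(n-3), \] where $\log$ is the natural logarithm.
   Context: For $n\ge 3$ let $\ell=n-3$. The bident $D_n$ is the graph with vertices $v_x,v_y,v_0,v_1,\dots,v_\ell$ and edges $v_xv_0$, $v_yv_0$, and $v_iv_{i+1}$ for $0\le i\le \ell-1$. For a finite connected graph $G$ with adjacency matrix $A$, an arithmetical structure on $G$ is a pair $(\mathbf d,\mathbf r)$ of vectors with positive integer entries indexed by the vertices such that $(\operatorname{diag}(\mathbf d)-A)\mathbf r=\mathbf 0$ and the entries of $\mathbf r$ have no nontrivial common factor. On $D_n$ write $\mathbf d=(d_x,d_y,d_0,\dots,d_\ell)$. An arithmetical structure on $D_n$ is smooth if $d_x,d_y,d_1,\dots,d_\ell\ge 2$; $\operatorname{SArith}(D_n)$ is the set of smooth arithmetical structures on $D_n$. *)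

theory Defs
  imports Complex_Main "HOL-Library.FuncSet"
begin

text \<open>
  A finite simple graph is given by its vertex set \<open>V\<close> and its set \<open>E\<close> of edges, each edge being the
  two-element set of its endpoints. Vectors indexed by \<open>V\<close> are functions that are extensional
  on \<open>V\<close>, so that distinct functions are distinct vectors.
\<close>

definition adjacency :: "'a set set \<Rightarrow> 'a \<Rightarrow> 'a \<Rightarrow> int" where
  "adjacency E u w = (if {u, w} \<in> E then 1 else 0)"

definition diag :: "('a \<Rightarrow> int) \<Rightarrow> 'a \<Rightarrow> 'a \<Rightarrow> int" where
  "diag d u w = (if u = w then d u else 0)"

definition arithmetical_structures :: "'a set \<Rightarrow> 'a set set \<Rightarrow> (('a \<Rightarrow> int) \<times> ('a \<Rightarrow> int)) set" where
  "arithmetical_structures V E =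
    {(d, r). d \<in> V \<rightarrow>\<^sub>E {0<..} \<and> r \<in> V \<rightarrow>\<^sub>E {0<..} \<and>
       (\<forall>u\<in>V. (\<Sum>w\<in>V. (diag d u w - adjacency E u w) * r w) = 0) \<and>
       Gcd (r ` V) = 1}"

datatype bident_vertex = VX | VY | VP nat

definition bident_verts :: "nat \<Rightarrow> bident_vertex set" where
  "bident_verts n = {VX, VY} \<union> VP ` {0..n - 3}"

definition bident_edges :: "nat \<Rightarrow> bident_vertex set set" where
  "bident_edges n = {{VX, VP 0}, {VY, VP 0}} \<union> {{VP i, VP (i + 1)} | i. i < n - 3}"

text \<open>The entry at the central vertex \<open>VP 0\<close> is not required to be at least 2.\<close>

definition SArith_bident :: "nat \<Rightarrow> ((bident_vertex \<Rightarrow> int) \<times> (bident_vertex \<Rightarrow> int)) set" where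
  "SArith_bident n =
    {(d, r) \<in> arithmetical_structures (bident_verts n) (bident_edges n).
       d VX \<ge> 2 \<and> d VY \<ge> 2 \<and> (\<forall>i\<in>{1..n - 3}. d (VP i) \<ge> 2)}"

end

theory Submission
  imports Defs
begin

text \<open>
  In a smooth structure the entries of \<open>r\<close> strictly decrease along the path, which forces
  \<open>d\<^sub>0 = 1\<close>, and the structure is determined by \<open>(a, b) = (d\<^sub>x, d\<^sub>y)\<close>. The path is the negative
  continued fraction of \<open>r\<^sub>0 / r\<^sub>1\<close>, where \<open>1 - r\<^sub>1 / r\<^sub>0 = 1/a + 1/b\<close>; its length is read off the subtractive
  Euclidean algorithm. Let \<open>L(x, u)\<close> be one more than the number of subtractions that
  reduce \<open>u\<close> in this algorithm. Then smooth structures on \<open>D\<^sub>n\<close> correspond to pairs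
  \<open>a, b \<ge> 2\<close> with \<open>L(a + b, ab) = N\<close>, where \<open>N = n - 2\<close>.

  Upper bound, for \<open>a \<le> b\<close>: from \<open>ab = a(a + b) - a\<^sup>2\<close> one gets \<open>L(a + b, ab) \<le> a - 2 + L(a\<^sup>2, a + b)\<close>, with
  equality once \<open>a\<^sup>2 \<le> a + b\<close>. As \<open>L(a\<^sup>2, c + a\<^sup>2) = L(a\<^sup>2, c) + 1\<close>, there is at most one \<open>b\<close> in
  each residue class modulo \<open>a\<^sup>2\<close>, which settles \<open>a \<le> N\<close>. Since \<open>u \<le> L(x, u) x\<close>, also
  \<open>ab \<le> N(a + b)\<close>, which bounds \<open>b\<close> by \<open>N + N\<^sup>2/j\<close> when \<open>a = N + j\<close>, and \<open>a\<close> by \<open>2N\<close>.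

  Lower bound: \<open>L(p, q) L(q, p) \<le> p + q\<close> shows that one of \<open>L(a\<^sup>2, c)\<close> and \<open>L(a\<^sup>2, a\<^sup>2 - c)\<close> is at most \<open>a\<close>. Hence at
  least half of the residues \<open>c\<close> modulo \<open>a\<^sup>2\<close> have \<open>L(a\<^sup>2, c) \<le> a\<close>, and if \<open>2a \<le> N + 1\<close> each of them
  yields a solution \<open>a + b = t a\<^sup>2 + c\<close> with \<open>t \<ge> 1\<close>.
\<close>

section \<open>Subtractive Euclidean algorithm\<close>

text \<open>The end \<open>x = u\<close> counts as a last subtraction from \<open>u\<close>. So this
  is the sum of the partial quotients of even index of the continued fraction of
  \<open>u / x\<close>, expanded to an odd number of terms.\<close>

fun euclid_len :: "nat \<Rightarrow> nat \<Rightarrow> nat" where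
  "euclid_len x u =
    (if x = 0 \<or> u = 0 then 0 else if x = u then 1
     else if u < x then euclid_len (x - u) u else Suc (euclid_len x (u - x)))"

declare euclid_len.simps [simp del]

lemma euclid_len_same [simp]: "0 < x \<Longrightarrow> euclid_len x x = 1"
  by (simp add: euclid_len.simps)

lemma euclid_len_add_left [simp]: "0 < x \<Longrightarrow> 0 < u \<Longrightarrow> euclid_len (x + u) u = euclid_len x u"
  by (subst euclid_len.simps) simp

lemma euclid_len_add_right [simp]: "0 < x \<Longrightarrow> 0 < u \<Longrightarrow> euclid_len x (u + x) = Suc (euclid_len x u)"
  by (subst euclid_len.simps) simp

lemma euclid_induct [consumes 2, case_names same left right]:
  assumes "0 < x" "0 < u"
    and "\<And>x. 0 < x \<Longrightarrow> P x x"
    and "\<And>x u. 0 < x \<Longrightarrow> 0 < u \<Longrightarrow> P x u \<Longrightarrow> P (x + u) u"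
    and "\<And>x u. 0 < x \<Longrightarrow> 0 < u \<Longrightarrow> P x u \<Longrightarrow> P x (u + x)"
  shows "P x (u :: nat)"
  using assms(1,2)
proof (induction "x + u" arbitrary: x u rule: less_induct)
  case less
  consider "x = u" | "u < x" | "x < u" by linarith
  then show ?case
  proof cases
    case 1
    then show ?thesis using assms(3) less.prems by simp
  next
    case 2
    then show ?thesis using assms(4)[of "x - u" u] less.hyps[of "x - u" u] less.prems by simp
  next
    case 3
    then show ?thesis using assms(5)[of x "u - x"] less.hyps[of x "u - x"] less.prems by simp
  qed
qed

lemma euclid_len_add_mult_left:
  assumes "0 < x" "0 < u"
  shows "euclid_len (x + k * u) u = euclid_len x u"
proof (induction k)
  case (Suc k)
  have "euclid_len (x + Suc k * u) u = euclid_len ((x + k * u) + u) u"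
    by (simp add: algebra_simps)
  also have "\<dots> = euclid_len x u"
    using Suc assms by (subst euclid_len_add_left) auto
  finally show ?case .
qed simp

lemma euclid_len_add_mult_right:
  assumes "0 < x" "0 < u"
  shows "euclid_len x (u + k * x) = k + euclid_len x u"
proof (induction k)
  case (Suc k)
  have "euclid_len x (u + Suc k * x) = euclid_len x ((u + k * x) + x)"
    by (simp add: algebra_simps)
  also have "\<dots> = Suc k + euclid_len x u"
    using Suc assms by (subst euclid_len_add_right) auto
  finally show ?case .
qed simp

section \<open>Size estimates for the length\<close>

lemma euclid_len_pos: "0 < x \<Longrightarrow> 0 < u \<Longrightarrow> 0 < euclid_len x u"
  by (induction x u rule: euclid_induct) auto

lemma euclid_len_mult_cancel:
  assumes "0 < g" "0 < x" "0 < u"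
  shows "euclid_len (g * x) (g * u) = euclid_len x u"
  using assms(2,3) by (induction x u rule: euclid_induct) (use assms(1) in \<open>auto simp: distrib_left\<close>)

lemma euclid_len_le_right: "0 < x \<Longrightarrow> 0 < u \<Longrightarrow> euclid_len x u \<le> u"
  by (induction x u rule: euclid_induct) auto

text \<open>Each counted subtraction removes the current first argument, which never exceeds the
  initial \<open>x\<close>.\<close>

lemma right_le_euclid_len_mult: "0 < x \<Longrightarrow> 0 < u \<Longrightarrow> u \<le> euclid_len x u * x"
  by (induction x u rule: euclid_induct) (auto simp: distrib_left trans_le_add1)

text \<open>Adding \<open>u\<close> to \<open>x\<close> fixes one factor and raises the other by 1,
  so the product grows by \<open>euclid_len x u\<close>, which is at most \<open>u\<close>. The
  other step is symmetric.\<close>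

lemma euclid_len_mult_swap_le: "0 < x \<Longrightarrow> 0 < u \<Longrightarrow> euclid_len x u * euclid_len u x \<le> x + u"
proof (induction x u rule: euclid_induct)
  case (left x u)
  then show ?case using euclid_len_le_right[of x u] by simp
next
  case (right x u)
  then show ?case using euclid_len_le_right[of u x] by simp
qed simp

text \<open>With \<open>w = y - x\<close> positive, \<open>a * y - x = w + (a - 1) * y\<close> has
  length \<open>a - 1 + L(y, w)\<close>. Here \<open>L(y, w) = L(x, w)\<close>, and
  \<open>L(x, y) = L(x, w) + 1\<close>.\<close>

lemma euclid_len_reflect_eq:
  assumes "0 < x" "x \<le> y" "x < a * y"
  shows "euclid_len y (a * y - x) + 2 = a + euclid_len x y"
proof (cases "x = y")
  case True
  then obtain k where a: "a = Suc (Suc k)"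
    using assms by (cases a; cases "a - 1") auto
  have "a * y - x = y + k * y" using True a by simp
  then show ?thesis
    using True a assms euclid_len_add_mult_right[of y y k] by simp
next
  case False
  then obtain w where w: "y = w + x" "0 < w"
    using assms by (metis add.commute le_neq_implies_less less_imp_add_positive)
  obtain k where a: "a = Suc k" using assms by (cases a) auto
  have "a * y - x = w + k * y" using w a by simp
  then have "euclid_len y (a * y - x) = k + euclid_len y w"
    using euclid_len_add_mult_right[of y w k] w by simp
  moreover have "euclid_len y w = euclid_len x w"
    using w assms by (metis add.commute euclid_len_add_left)
  ultimately show ?thesis using a w assms by simp
qed

text \<open>Replacing \<open>x\<close> and \<open>a\<close> by \<open>x - y\<close> and
  \<open>a - 1\<close> changes neither length, so each such step adds 1 to the slack. Once
  \<open>x <= y\<close>, equality holds.\<close>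

lemma euclid_len_reflect_le:
  assumes "0 < x" "0 < y" "x < a * y"
  shows "euclid_len y (a * y - x) + 2 \<le> a + euclid_len x y"
  using assms
proof (induction x arbitrary: a rule: less_induct)
  case (less x)
  show ?case
  proof (cases "x \<le> y")
    case True
    then show ?thesis using less.prems euclid_len_reflect_eq by simp
  next
    case False
    obtain k where a: "a = Suc k" using less.prems by (cases a) auto
    have "euclid_len y (k * y - (x - y)) + 2 \<le> k + euclid_len (x - y) y"
      using less.IH[of "x - y" k] False less.prems a by auto
    moreover have "a * y - x = k * y - (x - y)" using a False by simp
    moreover have "euclid_len x y = euclid_len (x - y) y"
      using False less.prems euclid_len_add_left[of "x - y" y] by simp
    ultimately show ?thesis using a by simp
  qed
qed

lemma euclid_len_sum_prod_le:
  assumes "0 < a" "0 < b"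
  shows "euclid_len (a + b) (a * b) + 2 \<le> a + euclid_len (a\<^sup>2) (a + b)"
  using euclid_len_reflect_le[of "a\<^sup>2" "a + b" a] assms
  by (simp add: power2_eq_square distrib_left)

lemma euclid_len_sum_prod_eq:
  assumes "0 < a" "0 < b" "a\<^sup>2 \<le> a + b"
  shows "euclid_len (a + b) (a * b) + 2 = a + euclid_len (a\<^sup>2) (a + b)"
  using euclid_len_reflect_eq[of "a\<^sup>2" "a + b" a] assms
  by (simp add: power2_eq_square distrib_left)

section \<open>Counting pairs by the length of their sum and product\<close>

definition sum_prod_pairs :: "nat \<Rightarrow> (nat \<times> nat) set" where
  "sum_prod_pairs N = {(a, b). 2 \<le> a \<and> 2 \<le> b \<and> euclid_len (a + b) (a * b) = N}"

section \<open>Upper bound for the number of pairs\<close>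

lemma sum_prod_pairs_swap: "(a, b) \<in> sum_prod_pairs N \<longleftrightarrow> (b, a) \<in> sum_prod_pairs N"
  by (auto simp: sum_prod_pairs_def ac_simps)

text \<open>If \<open>b < b'\<close> are congruent, then \<open>b' >= a^2\<close>, so the reflection
  identity is exact at \<open>b'\<close>. It gives \<open>N + 2 = a + k + L(a^2, a + b)\<close> with
  \<open>k > 0\<close>, against the upper bound at \<open>b\<close>.\<close>

lemma sum_prod_fibre_mod_inj:
  "inj_on (\<lambda>b. b mod a\<^sup>2) {b. (a, b) \<in> sum_prod_pairs N}"
proof -
  have False
    if b: "(a, b) \<in> sum_prod_pairs N" and b': "(a, b') \<in> sum_prod_pairs N"
      and eq: "b mod a\<^sup>2 = b' mod a\<^sup>2" and "b < b'" for b b'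
  proof -
    have a: "0 < a" "0 < b" "0 < b'" using b b' by (auto simp: sum_prod_pairs_def)
    have "a\<^sup>2 dvd b' - b" using eq \<open>b < b'\<close>
      by (metis mod_eq_dvd_iff_nat less_imp_le)
    then obtain k where k: "b' - b = k * a\<^sup>2" by (auto simp: dvd_def mult.commute)
    then have k': "b' = b + k * a\<^sup>2" "0 < k" using \<open>b < b'\<close> by (auto intro: ccontr)
    then have "a\<^sup>2 \<le> k * a\<^sup>2" by simp
    then have "a\<^sup>2 \<le> a + b'" using k' by linarith
    then have "N + 2 = a + euclid_len (a\<^sup>2) (a + b')"
      using euclid_len_sum_prod_eq[of a b'] a b' by (auto simp: sum_prod_pairs_def)
    also have "a + b' = (a + b) + k * a\<^sup>2" using k' by simp
    also have "euclid_len (a\<^sup>2) \<dots> = k + euclid_len (a\<^sup>2) (a + b)"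
      using a by (intro euclid_len_add_mult_right) auto
    finally show False
      using euclid_len_sum_prod_le[of a b] a b k' by (auto simp: sum_prod_pairs_def)
  qed
  then show ?thesis unfolding inj_on_def by (metis linorder_neqE_nat mem_Collect_eq)
qed

lemma card_sum_prod_fibre_le:
  assumes "0 < a"
  shows "finite {b. (a, b) \<in> sum_prod_pairs N}" "card {b. (a, b) \<in> sum_prod_pairs N} \<le> a\<^sup>2"
proof -
  have sub: "(\<lambda>b. b mod a\<^sup>2) ` {b. (a, b) \<in> sum_prod_pairs N} \<subseteq> {..<a\<^sup>2}"
    using assms by auto
  show "finite {b. (a, b) \<in> sum_prod_pairs N}"
    using inj_on_finite[OF sum_prod_fibre_mod_inj sub] by simp
  show "card {b. (a, b) \<in> sum_prod_pairs N} \<le> a\<^sup>2"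
    using card_inj_on_le[OF sum_prod_fibre_mod_inj sub] by simp
qed

lemma sum_prod_pairs_bound:
  "(a, b) \<in> sum_prod_pairs N \<Longrightarrow> a * b \<le> N * (a + b)"
  using right_le_euclid_len_mult[of "a + b" "a * b"] by (auto simp: sum_prod_pairs_def)

lemma card_sum_prod_large_fibre_le:
  assumes "1 \<le> j" "j \<le> N"
  shows "real (card {b. (N + j, b) \<in> sum_prod_pairs N \<and> N + j \<le> b}) \<le> (real N)\<^sup>2 / real j - real j + 1"
proof -
  have "b \<le> N + N\<^sup>2 div j" if "(N + j, b) \<in> sum_prod_pairs N" "N + j \<le> b" for b
  proof -
    have "(b - N) * j \<le> N\<^sup>2"
      using sum_prod_pairs_bound[OF that(1)] that(2)
      by (simp add: algebra_simps power2_eq_square)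
    then have "b - N \<le> N\<^sup>2 div j" using assms by (simp add: less_eq_div_iff_mult_less_eq)
    then show ?thesis by simp
  qed
  then have sub: "{b. (N + j, b) \<in> sum_prod_pairs N \<and> N + j \<le> b} \<subseteq> {N + j..N + N\<^sup>2 div j}"
    by auto
  \<comment> \<open>Needed so that the truncated subtraction in the cardinality of the interval
    agrees with real subtraction.\<close>
  have "j * j \<le> N\<^sup>2" using assms by (simp add: power2_eq_square mult_mono)
  then have j: "j \<le> N\<^sup>2 div j" using assms by (simp add: less_eq_div_iff_mult_less_eq)
  have "card {b. (N + j, b) \<in> sum_prod_pairs N \<and> N + j \<le> b} \<le> Suc (N\<^sup>2 div j) - j"
    using card_mono[OF _ sub] by simp
  also have "real \<dots> = real (N\<^sup>2 div j) - real j + 1" using j by (simp add: of_nat_diff)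
  also have "real (N\<^sup>2 div j) \<le> (real N)\<^sup>2 / real j"
    using of_nat_mono[OF times_div_less_eq_dividend[of j "N\<^sup>2"], where ?'a = real] assms
    by (simp add: field_simps)
  finally show ?thesis by simp
qed

lemma sum_squares_closed: "(\<Sum>a = 1..m. (real a)\<^sup>2) = real m * (real m + 1) * (2 * real m + 1) / 6"
  by (induction m) (auto simp: field_simps power2_eq_square)

text \<open>The induction step is \<open>ln t <= t - 1\<close> at
  \<open>t = m / (m + 1)\<close>.\<close>

lemma sum_inverse_le: "1 \<le> m \<Longrightarrow> (\<Sum>j = 1..m. 1 / real j) \<le> 1 + ln (real m)"
proof (induction m rule: dec_induct)
  case (step m)
  have "ln (real m / real (Suc m)) \<le> real m / real (Suc m) - 1"
    using step by (intro ln_le_minus_one) auto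
  also have "\<dots> = - (1 / real (Suc m))" by (simp add: field_simps)
  finally have "1 / real (Suc m) \<le> ln (real (Suc m)) - ln (real m)"
    using step by (simp add: ln_div)
  then show ?case using step by simp
qed simp

lemma sum_prod_pairs_upper:
  assumes "2 \<le> N"
  shows "finite (sum_prod_pairs N)"
    and "real (card (sum_prod_pairs N)) \<le>
      real N * (real N + 1) * (2 * real N + 1) / 3 - 2 + 2 * (real N)\<^sup>2 * (1 + ln (real N - 1)) + 2 * real N
        - real N * (real N + 1) + 2 * real N"
proof -
  \<comment> \<open>Only half fibres \<open>a <= b\<close> are counted. By symmetry twice their
    total suffices; diagonal pairs are then counted twice, which is harmless for an upper
    bound.\<close>
  define B where "B a = {b. (a, b) \<in> sum_prod_pairs N \<and> a \<le> b}" for a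
  define T where "T = Sigma {2..N + N} B"
  have finB: "finite (B a)" if "0 < a" for a
    using card_sum_prod_fibre_le(1)[OF that] by (rule finite_subset[rotated]) (auto simp: B_def)
  have finT: "finite T" unfolding T_def by (intro finite_SigmaI) (auto intro: finB)
  have inT: "(a, b) \<in> T" if ab: "(a, b) \<in> sum_prod_pairs N" "a \<le> b" for a b
  proof -
    have "a * b \<le> (N + N) * b"
      using sum_prod_pairs_bound[OF ab(1)] ab(2)
      by (metis (no_types, lifting) add_mono add_mult_distrib add_mult_distrib2 le_refl mult_le_mono2 order_trans)
    then have "a \<le> N + N" "2 \<le> a" using ab by (auto simp: sum_prod_pairs_def)
    then show ?thesis using ab by (auto simp: T_def B_def)
  qed
  have sub: "sum_prod_pairs N \<subseteq> T \<union> prod.swap ` T"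
  proof
    fix p assume "p \<in> sum_prod_pairs N"
    then obtain a b where p: "p = (a, b)" "(a, b) \<in> sum_prod_pairs N" by (cases p) auto
    show "p \<in> T \<union> prod.swap ` T"
    proof (cases "a \<le> b")
      case False
      then have "(b, a) \<in> T" using inT p sum_prod_pairs_swap by simp
      then show ?thesis using p by force
    qed (use p inT in simp)
  qed
  show "finite (sum_prod_pairs N)" using sub finT finite_subset by blast
  have "card (sum_prod_pairs N) \<le> card (T \<union> prod.swap ` T)"
    using sub finT by (intro card_mono) auto
  also have "\<dots> \<le> card T + card (prod.swap ` T)" by (rule card_Un_le)
  also have "\<dots> \<le> 2 * card T" using card_image_le[OF finT, of prod.swap] by simp
  finally have card2: "real (card (sum_prod_pairs N)) \<le> 2 * real (card T)" by linarith
  have "card T = (\<Sum>a = 2..N + N. card (B a))"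
    unfolding T_def by (intro card_SigmaI) (auto intro: finB)
  also have "{2..N + N} = {2..N} \<union> {N + 1..N + N}" using assms by auto
  also have "(\<Sum>a\<in>\<dots>. card (B a)) = (\<Sum>a = 2..N. card (B a)) + (\<Sum>a = N + 1..N + N. card (B a))"
    by (intro sum.union_disjoint) auto
  also have "(\<Sum>a = N + 1..N + N. card (B a)) = (\<Sum>j = 1..N. card (B (N + j)))"
    using sum.shift_bounds_cl_nat_ivl[of "\<lambda>a. card (B a)" 1 N N] by (simp add: add.commute)
  finally have "real (card T) = (\<Sum>a = 2..N. real (card (B a))) + (\<Sum>j = 1..N. real (card (B (N + j))))"
    by simp
  moreover have "(\<Sum>a = 2..N. real (card (B a))) \<le> (\<Sum>a = 2..N. (real a)\<^sup>2)"
  proof (rule sum_mono)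
    fix a assume a: "a \<in> {2..N}"
    have "card (B a) \<le> card {b. (a, b) \<in> sum_prod_pairs N}"
      using a card_sum_prod_fibre_le(1)[of a N] by (intro card_mono) (auto simp: B_def)
    also have "\<dots> \<le> a\<^sup>2" using a by (intro card_sum_prod_fibre_le) auto
    finally show "real (card (B a)) \<le> (real a)\<^sup>2" by (metis of_nat_mono of_nat_power)
  qed
  moreover have "(\<Sum>j = 1..N. real (card (B (N + j)))) \<le> (\<Sum>j = 1..N. (real N)\<^sup>2 / real j - real j + 1)"
    unfolding B_def by (intro sum_mono card_sum_prod_large_fibre_le) auto
  moreover have "(\<Sum>a = 2..N. (real a)\<^sup>2) = real N * (real N + 1) * (2 * real N + 1) / 6 - 1"
    using sum_squares_closed[of N] assms by (subst (asm) sum.atLeast_Suc_atMost) (auto simp: numeral_2_eq_2)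
  moreover have "(\<Sum>j = 1..N. (real N)\<^sup>2 / real j - real j + 1) =
      (real N)\<^sup>2 * (\<Sum>j = 1..N. 1 / real j) - (\<Sum>j = 1..N. real j) + real N"
    by (simp add: sum.distrib sum_subtractf sum_distrib_left)
  moreover have "(\<Sum>j = 1..N. real j) = real N * (real N + 1) / 2"
    by (induction N) (auto simp: field_simps)
  \<comment> \<open>Splitting off the last harmonic term costs \<open>N\<close> and leaves the
    logarithm of \<open>N - 1 = n - 3\<close>, as the theorem requires.\<close>
  moreover have "(real N)\<^sup>2 * (\<Sum>j = 1..N. 1 / real j) \<le> (real N)\<^sup>2 * (1 + ln (real N - 1)) + real N"
  proof -
    obtain m where m: "N = Suc m" "1 \<le> m" using assms by (cases N) auto
    have "(\<Sum>j = 1..N. 1 / real j) \<le> 1 + ln (real N - 1) + 1 / real N"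
      using sum_inverse_le[OF m(2)] m by simp
    then have "(real N)\<^sup>2 * (\<Sum>j = 1..N. 1 / real j) \<le> (real N)\<^sup>2 * (1 + ln (real N - 1) + 1 / real N)"
      by (intro mult_left_mono) auto
    also have "\<dots> = (real N)\<^sup>2 * (1 + ln (real N - 1)) + real N"
      using m by (simp add: field_simps power2_eq_square)
    finally show ?thesis .
  qed
  ultimately show "real (card (sum_prod_pairs N)) \<le>
      real N * (real N + 1) * (2 * real N + 1) / 3 - 2 + 2 * (real N)\<^sup>2 * (1 + ln (real N - 1)) + 2 * real N
        - real N * (real N + 1) + 2 * real N"
    using card2 by linarith
qed

section \<open>Lower bound for the number of pairs\<close>

definition short_residues :: "nat \<Rightarrow> nat set" where
  "short_residues a = {c \<in> {1..a\<^sup>2}. euclid_len (a\<^sup>2) c \<le> a}"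

text \<open>With \<open>p = a^2 - c\<close> the two lengths are \<open>L(p, c)\<close> and
  \<open>L(c, p)\<close>. Their product is at most \<open>p + c = a^2\<close>, so they cannot both
  exceed \<open>a\<close>.\<close>

lemma short_residue_or_complement:
  assumes "0 < c" "c < a\<^sup>2"
  shows "c \<in> short_residues a \<or> a\<^sup>2 - c \<in> short_residues a"
proof (rule ccontr)
  define p where "p = a\<^sup>2 - c"
  assume "\<not> ?thesis"
  then have *: "a < euclid_len (a\<^sup>2) c" "a < euclid_len (a\<^sup>2) p"
    using assms by (auto simp: short_residues_def p_def)
  have p: "a\<^sup>2 = p + c" "0 < p" using assms by (auto simp: p_def)
  then have "a < euclid_len p c" "a < euclid_len c p"
    using * assms euclid_len_add_left[of p c] euclid_len_add_left[of c p] by (auto simp: add.commute)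
  then have "a * a < euclid_len p c * euclid_len c p" by (intro mult_strict_mono) auto
  also have "\<dots> \<le> a * a"
    using euclid_len_mult_swap_le[of p c] p assms by (simp add: power2_eq_square)
  finally show False by simp
qed

text \<open>The class of 0 is represented by \<open>a^2\<close>, which has length 1 and counts in
  full. Reflection pairs up the other \<open>a^2 - 1\<close> residues, at least half of which are
  short.\<close>

lemma card_short_residues:
  assumes "0 < a"
  shows "a\<^sup>2 + 1 \<le> 2 * card (short_residues a)"
proof -
  define C where "C = short_residues a - {a\<^sup>2}"
  have fin: "finite C" "finite (short_residues a)" by (auto simp: C_def short_residues_def)
  have "{1..<a\<^sup>2} \<subseteq> C \<union> (\<lambda>c. a\<^sup>2 - c) ` C"
  proof
    fix c assume c: "c \<in> {1..<a\<^sup>2}"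
    then consider "c \<in> C" | "a\<^sup>2 - c \<in> C"
      using short_residue_or_complement[of c a] by (auto simp: C_def)
    then show "c \<in> C \<union> (\<lambda>c. a\<^sup>2 - c) ` C"
    proof cases
      case 2
      then show ?thesis using c by (intro UnI2 image_eqI[of _ _ "a\<^sup>2 - c"]) auto
    qed simp
  qed
  then have "card {1..<a\<^sup>2} \<le> card (C \<union> (\<lambda>c. a\<^sup>2 - c) ` C)"
    using fin by (intro card_mono) auto
  also have "\<dots> \<le> card C + card C"
    by (meson add_left_mono card_Un_le card_image_le fin(1) order_trans)
  finally have "a\<^sup>2 - 1 \<le> 2 * card C" by simp
  moreover have "a\<^sup>2 \<in> short_residues a" using assms by (simp add: short_residues_def)
  then have "card (short_residues a) = Suc (card C)"
    unfolding C_def using fin by (metis card_Suc_Diff1)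
  ultimately show ?thesis using assms by simp
qed

text \<open>The factor \<open>t\<close> of \<open>a^2\<close> is forced by
  \<open>N + 2 = a + t + L(a^2, c)\<close>. Both length and \<open>a\<close> are small enough that
  \<open>t >= 1\<close>, hence \<open>a + b >= a^2\<close> and the reflection identity is
  exact.\<close>

lemma short_residue_witness:
  assumes "2 \<le> a" "2 * a \<le> N + 1" "c \<in> short_residues a"
  defines "b \<equiv> (N + 2 - a - euclid_len (a\<^sup>2) c) * a\<^sup>2 + c - a"
  shows "(a, b) \<in> sum_prod_pairs N" "a < b" "(a + b) mod a\<^sup>2 = c mod a\<^sup>2"
proof -
  define t where "t = N + 2 - a - euclid_len (a\<^sup>2) c"
  have c: "0 < c" "euclid_len (a\<^sup>2) c \<le> a" using assms by (auto simp: short_residues_def)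
  then have t: "1 \<le> t" "t + a + euclid_len (a\<^sup>2) c = N + 2" using assms(1,2) by (auto simp: t_def)
  have "a\<^sup>2 * 1 \<le> a\<^sup>2 * t" using t by (intro mult_le_mono2)
  then have ta: "a\<^sup>2 \<le> t * a\<^sup>2" by (simp add: mult.commute)
  have aa: "2 * a \<le> a\<^sup>2" using assms(1) by (simp add: power2_eq_square)
  have b: "b = t * a\<^sup>2 + c - a" by (simp add: b_def t_def)
  have ab: "a + b = c + t * a\<^sup>2" using ta aa b by linarith
  show "a < b" using ta aa b c by linarith
  then have "0 < b" "2 \<le> b" using assms(1) by auto
  have "euclid_len (a\<^sup>2) (a + b) = t + euclid_len (a\<^sup>2) c"
    unfolding ab using assms(1) c by (intro euclid_len_add_mult_right) auto
  then have "euclid_len (a + b) (a * b) = N"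
    using euclid_len_sum_prod_eq[of a b] assms(1) \<open>0 < b\<close> t ab ta by simp
  then show "(a, b) \<in> sum_prod_pairs N" using assms(1) \<open>2 \<le> b\<close> by (simp add: sum_prod_pairs_def)
  show "(a + b) mod a\<^sup>2 = c mod a\<^sup>2" unfolding ab by simp
qed

lemma sum_prod_pairs_lower:
  assumes "finite (sum_prod_pairs N)"
  shows "(\<Sum>a = 2..(N + 1) div 2. a\<^sup>2 + 1) \<le> card (sum_prod_pairs N)"
proof -
  define M where "M = (N + 1) div 2"
  define U where "U = {(a, b) \<in> sum_prod_pairs N. a < b}"
  define F where "F = (\<lambda>(a, c). (a, (N + 2 - a - euclid_len (a\<^sup>2) c) * a\<^sup>2 + c - a))"
  have finU: "finite U" using assms by (rule finite_subset[rotated]) (auto simp: U_def)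
  have M: "2 * a \<le> N + 1" if "a \<le> M" for a using that by (simp add: M_def)
  have "inj_on F (Sigma {2..M} short_residues)"
  proof (rule inj_onI)
    fix p q assume p: "p \<in> Sigma {2..M} short_residues" and q: "q \<in> Sigma {2..M} short_residues"
      and eq: "F p = F q"
    obtain a c c' where pq: "p = (a, c)" "q = (a, c')"
      using eq by (cases p; cases q) (auto simp: F_def)
    have a: "2 \<le> a" "2 * a \<le> N + 1" "c \<in> short_residues a" "c' \<in> short_residues a"
      using p q pq M by auto
    have "c mod a\<^sup>2 = c' mod a\<^sup>2"
      using short_residue_witness(3)[OF a(1,2,3)] short_residue_witness(3)[OF a(1,2,4)] eq pq
      by (simp add: F_def)
    moreover have "c \<in> {1..a\<^sup>2}" "c' \<in> {1..a\<^sup>2}" using a by (auto simp: short_residues_def)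
    \<comment> \<open>Among the representatives from 1 to \<open>a^2\<close> only \<open>a^2\<close>
      itself has remainder 0.\<close>
    ultimately have "c = c'"
      by (cases "c = a\<^sup>2"; cases "c' = a\<^sup>2") auto
    then show "p = q" using pq by simp
  qed
  moreover have "F ` Sigma {2..M} short_residues \<subseteq> U"
    using short_residue_witness(1,2) M by (auto simp: F_def U_def)
  ultimately have "card (Sigma {2..M} short_residues) \<le> card U"
    using finU card_inj_on_le by blast
  moreover have "card (Sigma {2..M} short_residues) = (\<Sum>a = 2..M. card (short_residues a))"
    by (intro card_SigmaI) (auto simp: short_residues_def)
  ultimately have "2 * (\<Sum>a = 2..M. card (short_residues a)) \<le> 2 * card U" by simp
  moreover have "(\<Sum>a = 2..M. a\<^sup>2 + 1) \<le> 2 * (\<Sum>a = 2..M. card (short_residues a))"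
    unfolding sum_distrib_left by (intro sum_mono card_short_residues) auto
  \<comment> \<open>Since \<open>a < b\<close> on \<open>U\<close>, the swapped copy is disjoint.
    This doubling makes up for only half of the residues being short.\<close>
  moreover have "2 * card U = card (U \<union> prod.swap ` U)"
    using finU by (subst card_Un_disjoint) (auto simp: U_def card_image)
  moreover have "card (U \<union> prod.swap ` U) \<le> card (sum_prod_pairs N)"
    using sum_prod_pairs_swap by (intro card_mono assms) (auto simp: U_def)
  ultimately show ?thesis by (simp add: M_def)
qed

section \<open>Negative continued fractions\<close>

text \<open>The pair \<open>s 0, s 1\<close> itself need not decrease; this makes chains stable under both steps of the
  Euclidean algorithm.\<close>

definition descending_chain :: "nat \<Rightarrow> (nat \<Rightarrow> nat) \<Rightarrow> bool" where
  "descending_chain l s \<longleftrightarrow> 0 < s 0 \<and> s (Suc l) = 0 \<and>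
     (\<forall>i<l. s (Suc (Suc i)) < s (Suc i) \<and> s (Suc i) dvd s i + s (Suc (Suc i)))"

lemma descending_chain_pos: "descending_chain l s \<Longrightarrow> i \<le> l \<Longrightarrow> 0 < s i"
  by (cases i) (auto simp: descending_chain_def Suc_le_eq dest: gr_implies_not0)

text \<open>Dropping the first term lowers the length by 1: with \<open>w = s 1 - s 2\<close>,
  \<open>s 0\<close> is \<open>w\<close> plus a multiple of \<open>s 1\<close>, so \<open>L(s 0, s
  1) = L(w, w + s 2) = L(w, s 2) + 1 = L(s 1, s 2) + 1\<close>.\<close>

lemma descending_chain_euclid_len:
  "descending_chain (Suc l) s \<Longrightarrow> euclid_len (s 0) (s 1) = Suc l"
proof (induction l arbitrary: s)
  case 0
  then have s: "0 < s 0" "0 < s 1" "s 1 dvd s 0" by (auto simp: descending_chain_def)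
  then obtain k where "s 0 = s 1 * Suc k" by (metis dvdE mult_0_right not0_implies_Suc less_irrefl)
  then show ?case using euclid_len_add_mult_left[of "s 1" "s 1" k] s by (simp add: mult.commute)
next
  case (Suc l)
  have pos: "0 < s 0" "0 < s 1" "0 < s 2"
    using descending_chain_pos[OF Suc.prems, of 0] descending_chain_pos[OF Suc.prems, of 1]
      descending_chain_pos[OF Suc.prems, of 2] by auto
  have "descending_chain (Suc l) (\<lambda>i. s (Suc i))"
    using Suc.prems pos by (auto simp: descending_chain_def)
  then have IH: "euclid_len (s 1) (s 2) = Suc l"
    using Suc.IH[of "\<lambda>i. s (Suc i)"] by (simp add: numeral_2_eq_2)
  have s2: "s 2 < s 1" and dvd: "s 1 dvd s 0 + s 2"
    using Suc.prems by (auto simp: descending_chain_def numeral_2_eq_2)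
  then obtain k where k: "s 0 + s 2 = s 1 * Suc k"
    by (metis add_is_0 dvdE mult_0_right not0_implies_Suc pos(1) less_irrefl)
  obtain w where w: "s 1 = w + s 2" "0 < w" using s2 by (metis add.commute less_imp_add_positive)
  have "s 0 = w + k * s 1" using k w by (simp add: mult.commute)
  then have "euclid_len (s 0) (s 1) = euclid_len w (s 1)"
    using w pos by (simp only: euclid_len_add_mult_left)
  also have "\<dots> = Suc (euclid_len w (s 2))"
    using w pos euclid_len_add_right[of w "s 2"] by (metis add.commute)
  also have "euclid_len w (s 2) = euclid_len (s 1) (s 2)" using w pos by simp
  finally show ?case using IH by simp
qed

text \<open>The chain is built along the Euclidean algorithm. A step on \<open>x\<close> changes
  only \<open>s 0\<close>, by a multiple of \<open>s 1\<close>; a step on \<open>u\<close> lengthens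
  the chain by one term.\<close>

lemma descending_chain_exists:
  assumes "0 < x" "0 < u"
  shows "\<exists>s. descending_chain (euclid_len x u) s \<and> s 0 = x \<and> s 1 = u"
  using assms
proof (induction x u rule: euclid_induct)
  case (same x)
  then show ?case
    by (intro exI[of _ "\<lambda>i. if i \<le> 1 then x else 0"]) (auto simp: descending_chain_def)
next
  case (left x u)
  then obtain s where s: "descending_chain (euclid_len x u) s" "s 0 = x" "s 1 = u" by blast
  have "descending_chain (euclid_len x u) (s(0 := x + u))"
    unfolding descending_chain_def
  proof (intro conjI allI impI)
    fix i assume "i < euclid_len x u"
    then have "s (Suc (Suc i)) < s (Suc i)" "s (Suc i) dvd s i + s (Suc (Suc i))"
      using s by (auto simp: descending_chain_def)
    then show "(s(0 := x + u)) (Suc (Suc i)) < (s(0 := x + u)) (Suc i)"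
      and "(s(0 := x + u)) (Suc i) dvd (s(0 := x + u)) i + (s(0 := x + u)) (Suc (Suc i))"
    proof -
      assume dvd: "s (Suc i) dvd s i + s (Suc (Suc i))"
      show "(s(0 := x + u)) (Suc i) dvd (s(0 := x + u)) i + (s(0 := x + u)) (Suc (Suc i))"
      proof (cases "i = 0")
        case True
        have "u dvd (x + s (Suc 1)) + u" using dvd s True by simp
        then show ?thesis using True s(3) by (simp add: ac_simps)
      qed (use dvd in simp)
    qed simp
  qed (use s left.hyps in \<open>auto simp: descending_chain_def\<close>)
  moreover have "(s(0 := x + u)) 0 = x + u" "(s(0 := x + u)) 1 = u" using s by simp_all
  ultimately show ?case using euclid_len_add_left[OF left.hyps] by metis
next
  case (right x u)
  then obtain s where s: "descending_chain (euclid_len x u) s" "s 0 = x" "s 1 = u" by blast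
  \<comment> \<open>The new chain is \<open>x, u + x, u, s 2, ...\<close>.\<close>
  define s' where "s' = case_nat x (s(0 := u + x))"
  have len: "0 < euclid_len x u" using right.hyps by (rule euclid_len_pos)
  have "s' (Suc (Suc i)) < s' (Suc i) \<and> s' (Suc i) dvd s' i + s' (Suc (Suc i))"
    if "i < Suc (euclid_len x u)" for i
  proof -
    consider "i = 0" | "i = 1" | j where "i = Suc (Suc j)"
      by (metis One_nat_def not0_implies_Suc)
    then show ?thesis
    proof cases
      case 1
      then show ?thesis using s right.hyps by (simp add: s'_def add.commute)
    next
      case 2
      have "s 2 < u" "u dvd x + s 2"
        using s len by (auto simp: descending_chain_def numeral_2_eq_2)
      then show ?thesis using 2 s by (simp add: s'_def numeral_2_eq_2 add.assoc)
    next
      case 3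
      then show ?thesis using s that by (auto simp: s'_def descending_chain_def)
    qed
  qed
  moreover have "s' 0 = x" "s' 1 = u + x" "s' (Suc (Suc (euclid_len x u))) = 0"
    using s by (auto simp: s'_def descending_chain_def)
  ultimately show ?case using right.hyps
    by (intro exI[of _ s']) (auto simp: descending_chain_def)
qed

lemma eq_if_dvd_add:
  fixes m c x y :: nat
  assumes "m dvd c + x" "m dvd c + y" "x < m" "y < m"
  shows "x = y"
proof -
  have "m dvd x - y" "m dvd y - x"
    using dvd_diff_nat[OF assms(1,2)] dvd_diff_nat[OF assms(2,1)] by simp_all
  moreover have "x - y < m" "y - x < m" using assms(3,4) by auto
  ultimately have "x - y = 0" "y - x = 0" using nat_dvd_not_less by blast+
  then show ?thesis by simp
qed

text \<open>Each term is the least nonnegative residue of minus the term two places before, modulo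
  the preceding term.\<close>

lemma descending_chain_unique:
  assumes s: "descending_chain l s" and t: "descending_chain l t"
    and "s 0 = t 0" "s 1 = t 1" "i \<le> Suc l"
  shows "s i = t i"
  using assms(5)
proof (induction i rule: less_induct)
  case (less i)
  consider "i = 0" | "i = 1" | j where "i = Suc (Suc j)"
    by (metis One_nat_def not0_implies_Suc)
  then show ?case
  proof cases
    case 3
    then have eq: "s j = t j" "s (Suc j) = t (Suc j)" and j: "j < l" using less by auto
    have "s (Suc j) dvd s j + s i" "s (Suc j) dvd s j + t i" and lt: "s i < s (Suc j)" "t i < s (Suc j)"
      using s t j eq 3 by (auto simp: descending_chain_def)
    then show ?thesis by (intro eq_if_dvd_add)
  qed (use assms in auto)
qed

section \<open>Smooth structures on the bident\<close>

lemma arithmetical_row: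
  assumes "finite V" "u \<in> V"
  shows "(\<Sum>w\<in>V. (diag d u w - adjacency E u w) * r w) = d u * r u - sum r {w \<in> V. {u, w} \<in> E}"
proof -
  have "(\<Sum>w\<in>V. (diag d u w - adjacency E u w) * r w) =
      (\<Sum>w\<in>V. if w = u then d u * r u else 0) - (\<Sum>w\<in>V. if {u, w} \<in> E then r w else 0)"
    unfolding sum_subtractf[symmetric] by (rule sum.cong) (auto simp: diag_def adjacency_def left_diff_distrib)
  then show ?thesis using assms by (simp add: sum.delta sum.inter_filter)
qed

lemma bident_nbrs_leaf:
  "{w \<in> bident_verts n. {VX, w} \<in> bident_edges n} = {VP 0}"
  "{w \<in> bident_verts n. {VY, w} \<in> bident_edges n} = {VP 0}"
  by (auto simp: bident_verts_def bident_edges_def doubleton_eq_iff)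

lemma bident_nbrs_centre:
  "4 \<le> n \<Longrightarrow> {w \<in> bident_verts n. {VP 0, w} \<in> bident_edges n} = {VX, VY, VP 1}"
  by (auto simp: bident_verts_def bident_edges_def doubleton_eq_iff)

lemma bident_nbrs_path:
  "i \<in> {1..n - 3} \<Longrightarrow> {w \<in> bident_verts n. {VP i, w} \<in> bident_edges n} =
     insert (VP (i - 1)) (if i < n - 3 then {VP (Suc i)} else {})"
  by (cases i) (auto simp: bident_verts_def bident_edges_def doubleton_eq_iff image_iff)

lemma SArith_bident_iff:
  assumes "4 \<le> n"
  shows "(d, r) \<in> SArith_bident n \<longleftrightarrow>
    d \<in> bident_verts n \<rightarrow>\<^sub>E {0<..} \<and> r \<in> bident_verts n \<rightarrow>\<^sub>E {0<..} \<and>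
    Gcd (r ` bident_verts n) = 1 \<and> 2 \<le> d VX \<and> 2 \<le> d VY \<and>
    d VX * r VX = r (VP 0) \<and> d VY * r VY = r (VP 0) \<and>
    d (VP 0) * r (VP 0) = r VX + r VY + r (VP 1) \<and>
    (\<forall>i\<in>{1..n - 3}. 2 \<le> d (VP i) \<and>
       d (VP i) * r (VP i) = r (VP (i - 1)) + (if i < n - 3 then r (VP (Suc i)) else 0))"
proof -
  have fin: "finite (bident_verts n)" by (simp add: bident_verts_def)
  have V: "bident_verts n = {VX, VY, VP 0} \<union> VP ` {1..n - 3}"
  proof -
    have "{0..n - 3} = insert 0 {1..n - 3}" by auto
    then show ?thesis by (auto simp: bident_verts_def)
  qed
  have "(\<forall>u\<in>bident_verts n. (\<Sum>w\<in>bident_verts n. (diag d u w - adjacency (bident_edges n) u w) * r w) = 0)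
    \<longleftrightarrow> (\<forall>u\<in>bident_verts n. d u * r u = sum r {w \<in> bident_verts n. {u, w} \<in> bident_edges n})"
    by (intro ball_cong refl) (simp add: arithmetical_row[OF fin])
  also have "\<dots> \<longleftrightarrow> d VX * r VX = r (VP 0) \<and> d VY * r VY = r (VP 0) \<and>
      d (VP 0) * r (VP 0) = r VX + r VY + r (VP 1) \<and>
      (\<forall>i\<in>{1..n - 3}. d (VP i) * r (VP i) = sum r {w \<in> bident_verts n. {VP i, w} \<in> bident_edges n})"
  proof -
    have V': "(\<forall>u\<in>bident_verts n. P u) \<longleftrightarrow> P VX \<and> P VY \<and> P (VP 0) \<and> (\<forall>i\<in>{1..n - 3}. P (VP i))" for P
      unfolding V by auto
    show ?thesis
      unfolding V'[of "\<lambda>u. d u * r u = sum r {w \<in> bident_verts n. {u, w} \<in> bident_edges n}"]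
        bident_nbrs_leaf bident_nbrs_centre[OF assms] by (simp add: add.assoc)
  qed
  also have "(\<forall>i\<in>{1..n - 3}. d (VP i) * r (VP i) = sum r {w \<in> bident_verts n. {VP i, w} \<in> bident_edges n})
    \<longleftrightarrow> (\<forall>i\<in>{1..n - 3}. d (VP i) * r (VP i) = r (VP (i - 1)) + (if i < n - 3 then r (VP (Suc i)) else 0))"
    by (intro ball_cong refl) (subst bident_nbrs_path, auto)
  finally show ?thesis
    by (auto simp: SArith_bident_def arithmetical_structures_def)
qed

text \<open>Scaling \<open>(a + b, a * b)\<close> by \<open>x * y\<close> gives
  \<open>(r * (x + y), r * r)\<close>, and the length depends only on the ratio.\<close>

lemma euclid_len_unit_fractions:
  assumes "a * x = r" "b * y = r" "0 < r"
  shows "euclid_len (a + b) (a * b) = euclid_len (x + y) (r :: nat)"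
proof -
  have pos: "0 < a" "0 < x" "0 < b" "0 < y" using assms by (auto intro: ccontr)
  have "euclid_len (a + b) (a * b) = euclid_len ((x * y) * (a + b)) ((x * y) * (a * b))"
    using pos by (intro euclid_len_mult_cancel[symmetric]) auto
  also have "(x * y) * (a + b) = (a * x) * y + (b * y) * x" by (simp add: algebra_simps)
  also have "\<dots> = r * (x + y)" by (simp add: assms algebra_simps)
  also have "(x * y) * (a * b) = (a * x) * (b * y)" by simp
  also have "\<dots> = r * r" by (simp add: assms)
  also have "euclid_len (r * (x + y)) (r * r) = euclid_len (x + y) r"
    using assms pos by (intro euclid_len_mult_cancel) auto
  finally show ?thesis .
qed

text \<open>The value 0 beyond the path gives the last row the same form as the others and ends the
  chain.\<close>

definition path_entries :: "nat \<Rightarrow> (bident_vertex \<Rightarrow> int) \<Rightarrow> nat \<Rightarrow> nat" where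
  "path_entries n r i = (if i \<le> n - 3 then nat (r (VP i)) else 0)"

section \<open>From a structure to a pair\<close>

lemma SArith_bident_pos:
  assumes "4 \<le> n" "(d, r) \<in> SArith_bident n"
  shows "0 < r VX" "0 < r VY" "\<And>i. i \<le> n - 3 \<Longrightarrow> 0 < r (VP i)"
proof -
  have "r \<in> bident_verts n \<rightarrow>\<^sub>E {0<..}" using assms SArith_bident_iff by simp
  then have "0 < r v" if "v \<in> bident_verts n" for v using that by (auto dest: PiE_mem)
  then show "0 < r VX" "0 < r VY" "\<And>i. i \<le> n - 3 \<Longrightarrow> 0 < r (VP i)"
    by (auto simp: bident_verts_def)
qed

lemma path_entries_row:
  assumes "4 \<le> n" "(d, r) \<in> SArith_bident n" "i < n - 3"
  shows "nat (d (VP (Suc i))) * path_entries n r (Suc i) = path_entries n r i + path_entries n r (Suc (Suc i))"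
proof -
  have "2 \<le> d (VP (Suc i))"
    and eq: "d (VP (Suc i)) * r (VP (Suc i)) =
      r (VP i) + (if Suc i < n - 3 then r (VP (Suc (Suc i))) else 0)"
    using assms SArith_bident_iff[OF assms(1), of d r] by (auto dest: bspec[of _ _ "Suc i"])
  then have "nat (d (VP (Suc i))) * nat (r (VP (Suc i))) =
      nat (r (VP i) + (if Suc i < n - 3 then r (VP (Suc (Suc i))) else 0))"
    by (simp flip: nat_mult_distrib)
  then show ?thesis
    using SArith_bident_pos(3)[OF assms(1,2), of i] SArith_bident_pos(3)[OF assms(1,2), of "Suc (Suc i)"]
      assms(3) by (auto simp: path_entries_def nat_add_distrib)
qed

text \<open>Induction from the end of the path: entries of \<open>d\<close> at least 2 make the
  sequence convex, and its last step, to 0, is a descent.\<close>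

lemma path_entries_decreasing:
  assumes "4 \<le> n" "(d, r) \<in> SArith_bident n" "i \<le> n - 3"
  shows "path_entries n r (Suc i) < path_entries n r i"
  using assms(3)
proof (induction i rule: inc_induct)
  case base
  show ?case using SArith_bident_pos(3)[OF assms(1,2), of "n - 3"] by (simp add: path_entries_def)
next
  case (step i)
  have "2 \<le> d (VP (Suc i))"
    using assms step.hyps SArith_bident_iff[OF assms(1), of d r] by (auto dest: bspec[of _ _ "Suc i"])
  then have "2 * path_entries n r (Suc i) \<le> nat (d (VP (Suc i))) * path_entries n r (Suc i)"
    by (intro mult_right_mono) auto
  then show ?case using path_entries_row[OF assms(1,2) step.hyps(2)] step.IH by linarith
qed

lemma path_entries_chain:
  assumes "4 \<le> n" "(d, r) \<in> SArith_bident n"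
  shows "descending_chain (n - 3) (path_entries n r)"
  unfolding descending_chain_def
proof (intro conjI allI impI)
  show "0 < path_entries n r 0"
    using SArith_bident_pos(3)[OF assms, of 0] by (simp add: path_entries_def)
  show "path_entries n r (Suc (n - 3)) = 0" by (simp add: path_entries_def)
  fix i assume i: "i < n - 3"
  show "path_entries n r (Suc (Suc i)) < path_entries n r (Suc i)"
    using path_entries_decreasing[OF assms] i by simp
  show "path_entries n r (Suc i) dvd path_entries n r i + path_entries n r (Suc (Suc i))"
    using path_entries_row[OF assms i] by (metis dvd_triv_right)
qed

text \<open>Each leaf entry is at most half of \<open>r (VP 0)\<close> and \<open>r (VP 1)\<close>
  is smaller than it, so the sum at the centre lies strictly between 0 and
  \<open>2 * r (VP 0)\<close>.\<close>

lemma SArith_bident_centre: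
  assumes "4 \<le> n" "(d, r) \<in> SArith_bident n"
  shows "d (VP 0) = 1"
proof -
  have e: "2 \<le> d VX" "2 \<le> d VY" "d VX * r VX = r (VP 0)" "d VY * r VY = r (VP 0)"
    "d (VP 0) * r (VP 0) = r VX + r VY + r (VP 1)"
    using assms SArith_bident_iff by auto
  have pos: "0 < r VX" "0 < r VY" "0 < r (VP 0)" "0 < r (VP 1)"
    using SArith_bident_pos[OF assms] assms(1) by auto
  have "2 * r VX \<le> r (VP 0)" "2 * r VY \<le> r (VP 0)"
    using mult_right_mono[OF e(1), of "r VX"] mult_right_mono[OF e(2), of "r VY"] e pos by auto
  moreover have "r (VP 1) < r (VP 0)"
    using path_entries_decreasing[OF assms, of 0] pos assms(1) by (auto simp: path_entries_def split: if_splits)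
  ultimately have "d (VP 0) * r (VP 0) < 2 * r (VP 0)" "0 * r (VP 0) < d (VP 0) * r (VP 0)"
    using e(5) pos by linarith+
  then have "d (VP 0) < 2" "0 < d (VP 0)"
    using pos mult_less_cancel_right_pos[OF pos(3)] by blast+
  then show ?thesis by simp
qed

text \<open>A common divisor of the leaf entries divides the central entry, then
  \<open>r (VP 1)\<close>, and by the recurrence the whole path.\<close>

lemma SArith_bident_coprime:
  assumes "4 \<le> n" "(d, r) \<in> SArith_bident n"
  shows "coprime (r VX) (r VY)"
proof (rule coprimeI)
  fix g assume g: "g dvd r VX" "g dvd r VY"
  have e: "d VX * r VX = r (VP 0)" "d (VP 0) * r (VP 0) = r VX + r VY + r (VP 1)"
    "Gcd (r ` bident_verts n) = 1"
    and row: "\<And>i. i \<in> {1..n - 3} \<Longrightarrow>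
      d (VP i) * r (VP i) = r (VP (i - 1)) + (if i < n - 3 then r (VP (Suc i)) else 0)"
    using assms SArith_bident_iff by auto
  have g0: "g dvd r (VP 0)" using g e(1) by (metis dvd_mult)
  have "r (VP 1) = d (VP 0) * r (VP 0) - r VX - r VY" using e(2) by simp
  then have g1: "g dvd r (VP 1)" using g g0 by simp
  have path: "g dvd r (VP i)" if "i \<le> n - 3" for i
    using that
  proof (induction i rule: less_induct)
    case (less i)
    consider "i = 0" | "i = 1" | j where "i = Suc (Suc j)"
      by (metis One_nat_def not0_implies_Suc)
    then show ?case
    proof cases
      case 3
      then have "g dvd r (VP j)" "g dvd r (VP (Suc j))" using less by auto
      moreover have "r (VP i) = d (VP (Suc j)) * r (VP (Suc j)) - r (VP j)"
        using row[of "Suc j"] 3 less.prems by simp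
      ultimately show ?thesis by simp
    qed (use g0 g1 in auto)
  qed
  have "g dvd Gcd (r ` bident_verts n)"
    using g path by (intro Gcd_greatest) (auto simp: bident_verts_def)
  then show "g dvd 1" using e(3) by simp
qed

text \<open>With \<open>s = r VX + r VY\<close>, the length is
  \<open>L(s, r0) = 1 + L(s, r1) = 1 + L(r0, r1)\<close> because \<open>r0 = s + r1\<close>; the
  path contributes \<open>n - 3\<close>.\<close>

lemma SArith_bident_image:
  assumes "4 \<le> n" "(d, r) \<in> SArith_bident n"
  shows "(nat (d VX), nat (d VY)) \<in> sum_prod_pairs (n - 2)"
proof -
  have e: "2 \<le> d VX" "2 \<le> d VY" "d VX * r VX = r (VP 0)" "d VY * r VY = r (VP 0)"
    "r (VP 0) = r VX + r VY + r (VP 1)"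
    using assms SArith_bident_iff SArith_bident_centre[OF assms] by auto
  have pos: "0 < r VX" "0 < r VY" "0 < r (VP 0)" "0 < r (VP 1)"
    using SArith_bident_pos[OF assms] assms(1) by auto
  have "nat (d VX) * nat (r VX) = nat (r (VP 0))" "nat (d VY) * nat (r VY) = nat (r (VP 0))"
    using e by (auto simp flip: nat_mult_distrib)
  then have "euclid_len (nat (d VX) + nat (d VY)) (nat (d VX) * nat (d VY)) =
      euclid_len (nat (r VX) + nat (r VY)) (nat (r (VP 0)))"
    using pos by (intro euclid_len_unit_fractions) auto
  also have "nat (r (VP 0)) = nat (r (VP 1)) + (nat (r VX) + nat (r VY))" using e(5) pos by simp
  also have "euclid_len (nat (r VX) + nat (r VY)) \<dots> =
      Suc (euclid_len (nat (r VX) + nat (r VY)) (nat (r (VP 1))))"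
    using pos by (intro euclid_len_add_right) auto
  also have "euclid_len (nat (r VX) + nat (r VY)) (nat (r (VP 1))) =
      euclid_len ((nat (r VX) + nat (r VY)) + nat (r (VP 1))) (nat (r (VP 1)))"
    using pos by (intro euclid_len_add_left[symmetric]) auto
  also have "(nat (r VX) + nat (r VY)) + nat (r (VP 1)) = nat (r (VP 0))" using e(5) pos by simp
  also have "euclid_len (nat (r (VP 0))) (nat (r (VP 1))) = n - 3"
  proof -
    obtain m where m: "n - 3 = Suc m" using assms(1) by (cases "n - 3") auto
    then show ?thesis
      using descending_chain_euclid_len[of m "path_entries n r"] path_entries_chain[OF assms]
      by (simp add: path_entries_def)
  qed
  finally show ?thesis using e(1,2) assms(1) by (auto simp: sum_prod_pairs_def)
qed

section \<open>Uniqueness and existence of the structure for a given pair\<close>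

lemma coprime_proportional_unique:
  fixes x y x' y' a b :: int
  assumes "coprime x y" "coprime x' y'" "0 < x" "0 < x'" "0 < a" "0 < b"
    and "a * x = b * y" "a * x' = b * y'"
  shows "x = x'"
proof -
  have "(a * b) * (x * y') = (a * x) * (b * y')" by simp
  also have "\<dots> = (b * y) * (a * x')" using assms by simp
  also have "\<dots> = (a * b) * (x' * y)" by simp
  finally have "x * y' = x' * y" using assms by simp
  then have "x dvd x'" "x' dvd x"
    using assms(1,2) by (metis coprime_dvd_mult_left_iff dvd_triv_left)+
  then show ?thesis using assms by (simp add: zdvd_antisym_nonneg)
qed

text \<open>The leaf entries of \<open>r\<close> are the reduced form of \<open>d VY / d VX\<close>.
  They determine \<open>r (VP 0)\<close> and \<open>r (VP 1)\<close>, hence the chain, and the rows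
  then return \<open>d\<close>.\<close>

lemma SArith_bident_inj:
  assumes "4 \<le> n" "(d, r) \<in> SArith_bident n" "(d', r') \<in> SArith_bident n"
    and "d VX = d' VX" "d VY = d' VY"
  shows "d = d' \<and> r = r'"
proof -
  note S = assms(2)[unfolded SArith_bident_iff[OF assms(1)]]
  note S' = assms(3)[unfolded SArith_bident_iff[OF assms(1)]]
  note pos = SArith_bident_pos[OF assms(1,2)]
  note pos' = SArith_bident_pos[OF assms(1,3)]
  have cop: "coprime (r VX) (r VY)" "coprime (r' VX) (r' VY)"
    using SArith_bident_coprime assms by blast+
  have props: "d VX * r VX = d VY * r VY" "d VX * r' VX = d VY * r' VY"
    using S S' assms(4,5) by simp_all
  have d0: "0 < d VX" "0 < d VY" using S by auto
  have x: "r VX = r' VX"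
    using coprime_proportional_unique[OF cop pos(1) pos'(1) d0 props] .
  have y: "r VY = r' VY"
    using props x d0 by simp
  have r0: "r (VP 0) = r' (VP 0)" using S S' x assms(4) by metis
  have r1: "r (VP 1) = r' (VP 1)"
    using S S' x y r0 SArith_bident_centre[OF assms(1,2)] SArith_bident_centre[OF assms(1,3)] by simp
  have path: "r (VP i) = r' (VP i)" if "i \<le> n - 3" for i
  proof -
    have "path_entries n r i = path_entries n r' i"
      by (rule descending_chain_unique[OF path_entries_chain[OF assms(1,2)] path_entries_chain[OF assms(1,3)]])
        (use r0 r1 that assms(1) in \<open>auto simp: path_entries_def\<close>)
    then show ?thesis using that pos(3)[OF that] pos'(3)[OF that] by (simp add: path_entries_def)
  qed
  have r: "r = r'"
    by (rule PiE_ext[of _ "bident_verts n" "\<lambda>_. {0<..}"]) (use S S' x y path in \<open>auto simp: bident_verts_def\<close>)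
  have dp: "d (VP i) = d' (VP i)" if "i \<le> n - 3" for i
  proof (cases "i = 0")
    case True
    then show ?thesis
      using SArith_bident_centre[OF assms(1,2)] SArith_bident_centre[OF assms(1,3)] by simp
  next
    case False
    then have "i \<in> {1..n - 3}" using that by simp
    then have "d (VP i) * r (VP i) = d' (VP i) * r (VP i)" using S S' r by metis
    then show ?thesis using pos(3)[OF that] by simp
  qed
  have "d = d'"
    by (rule PiE_ext[of _ "bident_verts n" "\<lambda>_. {0<..}"])
      (use S S' assms(4,5) dp in \<open>auto simp: bident_verts_def\<close>)
  with r show ?thesis by simp
qed

lemma SArith_bident_surj:
  assumes "4 \<le> n" "(a, b) \<in> sum_prod_pairs (n - 2)"
  shows "\<exists>d r. (d, r) \<in> SArith_bident n \<and> d VX = int a \<and> d VY = int b"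
proof -
  have ab: "2 \<le> a" "2 \<le> b" "euclid_len (a + b) (a * b) = n - 2"
    using assms(2) by (auto simp: sum_prod_pairs_def)
  \<comment> \<open>Here \<open>R\<close> is the least common multiple of \<open>a\<close> and
    \<open>b\<close>; this choice makes the leaf entries coprime.\<close>
  define x y R where "x = b div gcd a b" and "y = a div gcd a b" and "R = a * x"
  have cop: "coprime x y" using ab by (simp add: x_def y_def coprime_commute div_gcd_coprime)
  have R': "b * y = R"
    by (simp add: R_def x_def y_def div_mult_swap dvd_div_mult mult.commute)
  have "R \<noteq> 0" using ab by (auto simp: R_def x_def dvd_div_eq_0_iff)
  then have pos: "0 < x" "0 < y" "0 < R" using R' by (auto simp: R_def intro: ccontr)
  have len: "euclid_len (x + y) R = n - 2"
    using euclid_len_unit_fractions[of a x R b y] R' pos ab by (simp add: R_def)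
  have "2 * x \<le> R" "2 * y \<le> R"
    using ab mult_le_mono1[OF ab(1), of x] mult_le_mono1[OF ab(2), of y] R' by (auto simp: R_def)
  \<comment> \<open>Equality would give length 1, but \<open>n - 2 >= 2\<close>. Strictness leaves
    room for a positive \<open>r (VP 1)\<close>.\<close>
  moreover have "x + y \<noteq> R" using len pos assms(1) by auto
  ultimately have "x + y < R" by simp
  then obtain u where u: "R = u + (x + y)" "0 < u"
    by (metis add.commute less_imp_add_positive)
  have "Suc (euclid_len (x + y) u) = n - 2" using len u pos by simp
  moreover have "euclid_len R u = euclid_len (x + y) u"
    using u pos euclid_len_add_left[of "x + y" u] by (metis add.commute add_pos_pos)
  ultimately have "euclid_len R u = n - 3" by simp
  then obtain s where s: "descending_chain (n - 3) s" "s 0 = R" "s 1 = u"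
    using descending_chain_exists[OF pos(3) u(2)] by metis
  define e where "e i = (s (i - 1) + s (Suc i)) div s i" for i
  have e: "e i * s i = s (i - 1) + s (Suc i)" "2 \<le> e i" if i: "i \<in> {1..n - 3}" for i
  proof -
    obtain j where j: "i = Suc j" "j < n - 3" using i by (cases i) auto
    then show eq: "e i * s i = s (i - 1) + s (Suc i)"
      using s(1) by (auto simp: e_def descending_chain_def)
    have lt: "s i < s (i - 1)"
    proof (cases j)
      case 0
      then show ?thesis using j s u pos by simp
    next
      case (Suc k)
      then show ?thesis using j s(1) by (simp add: descending_chain_def)
    qed
    show "2 \<le> e i"
    proof (rule ccontr)
      assume "\<not> 2 \<le> e i"
      then have "e i * s i \<le> 1 * s i" by (intro mult_le_mono1) simp
      then show False using eq lt by simp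
    qed
  qed
  have spos: "0 < s i" if "i \<le> n - 3" for i using descending_chain_pos[OF s(1) that] .
  have slast: "s (Suc (n - 3)) = 0" using s(1) by (simp add: descending_chain_def)
  \<comment> \<open>Vectors are extensional, so the value off the bident must be
    \<open>undefined\<close>.\<close>
  define r where "r v = (case v of VX \<Rightarrow> int x | VY \<Rightarrow> int y
    | VP i \<Rightarrow> if i \<le> n - 3 then int (s i) else undefined)" for v
  define d where "d v = (case v of VX \<Rightarrow> int a | VY \<Rightarrow> int b
    | VP i \<Rightarrow> if i = 0 then 1 else if i \<le> n - 3 then int (e i) else undefined)" for v
  have "(d, r) \<in> SArith_bident n"
    unfolding SArith_bident_iff[OF assms(1)]
  proof (intro conjI ballI)
    have e0: "0 < e i" if "0 < i" "i \<le> n - 3" for i using e(2)[of i] that by auto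
    show "d \<in> bident_verts n \<rightarrow>\<^sub>E {0<..}"
      using ab e0 by (auto simp: d_def bident_verts_def PiE_def extensional_def split: bident_vertex.splits)
    show "r \<in> bident_verts n \<rightarrow>\<^sub>E {0<..}"
      using pos spos by (auto simp: r_def bident_verts_def PiE_def extensional_def split: bident_vertex.splits)
    have "Gcd (r ` bident_verts n) dvd r VX" "Gcd (r ` bident_verts n) dvd r VY"
      by (rule Gcd_dvd, simp add: bident_verts_def)+
    then have "is_unit (Gcd (r ` bident_verts n))"
      using cop by (intro coprime_common_divisor[of "int x" "int y"]) (auto simp: r_def)
    then show "Gcd (r ` bident_verts n) = 1" by simp
    show "d VX * r VX = r (VP 0)" "d VY * r VY = r (VP 0)"
      using s R' by (auto simp: d_def r_def R_def simp flip: of_nat_mult)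
    show "d (VP 0) * r (VP 0) = r VX + r VY + r (VP 1)"
      using s u assms(1) by (auto simp: d_def r_def)
    fix i assume i: "i \<in> {1..n - 3}"
    show "2 \<le> d (VP i)" using e(2)[OF i] i by (simp add: d_def)
    have "int (e i) * int (s i) = int (s (i - 1)) + int (s (Suc i))"
      using e(1)[OF i] by (metis of_nat_add of_nat_mult)
    moreover have "s (Suc i) = 0" if "\<not> i < n - 3"
      using that i slast by (metis atLeastAtMost_iff le_neq_implies_less)
    ultimately show "d (VP i) * r (VP i) = r (VP (i - 1)) + (if i < n - 3 then r (VP (Suc i)) else 0)"
      using i by (auto simp: d_def r_def)
  qed (use ab in \<open>auto simp: d_def\<close>)
  then show ?thesis by (intro exI[of _ d] exI[of _ r]) (simp add: d_def)
qed

lemma SArith_bident_bij: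
  assumes "4 \<le> n"
  shows "bij_betw (\<lambda>(d, r). (nat (d VX), nat (d VY))) (SArith_bident n) (sum_prod_pairs (n - 2))"
  unfolding bij_betw_def
proof
  show "inj_on (\<lambda>(d, r). (nat (d VX), nat (d VY))) (SArith_bident n)"
  proof (rule inj_onI, clarify)
    fix d r d' r'
    assume S: "(d, r) \<in> SArith_bident n" "(d', r') \<in> SArith_bident n"
      and eq: "nat (d VX) = nat (d' VX)" "nat (d VY) = nat (d' VY)"
    have "2 \<le> d VX" "2 \<le> d VY" "2 \<le> d' VX" "2 \<le> d' VY"
      using S SArith_bident_iff[OF assms] by auto
    then have "d VX = d' VX" "d VY = d' VY" using eq by auto
    then show "d = d' \<and> r = r'" using SArith_bident_inj[OF assms S] by simp
  qed
  show "(\<lambda>(d, r). (nat (d VX), nat (d VY))) ` SArith_bident n = sum_prod_pairs (n - 2)"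
  proof (intro equalityI subsetI)
    fix p assume "p \<in> sum_prod_pairs (n - 2)"
    then obtain a b d r where p: "p = (a, b)" and dr: "(d, r) \<in> SArith_bident n"
      "d VX = int a" "d VY = int b"
      using SArith_bident_surj[OF assms] by (cases p) blast
    show "p \<in> (\<lambda>(d, r). (nat (d VX), nat (d VY))) ` SArith_bident n"
      by (rule image_eqI[OF _ dr(1)]) (simp add: p dr)
  qed (use SArith_bident_image[OF assms] in auto)
qed

section \<open>The two bounds in terms of \<open>n\<close>\<close>

theorem theorem4p1:
  fixes n :: nat
  assumes "n \<ge> 4"
  shows "finite (SArith_bident n) \<and>
    1 / 24 * (real n ^ 3 - 3 * real n ^ 2 - real n - 45) \<le> real (card (SArith_bident n)) \<and>
    real (card (SArith_bident n)) <
      2 / 3 * real n ^ 3 - 2 * real n ^ 2 + 16 / 3 * real n - 6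
        + (2 * real n ^ 2 - 4 * real n + 2) * ln (real n - 3)"
proof -
  define N where "N = n - 2"
  have N: "2 \<le> N" "real n = real N + 2" using assms by (auto simp: N_def)
  have fin: "finite (sum_prod_pairs N)" using sum_prod_pairs_upper(1)[OF N(1)] .
  have card: "card (SArith_bident n) = card (sum_prod_pairs N)"
    using bij_betw_same_card[OF SArith_bident_bij[OF assms]] by (simp add: N_def)
  have finS: "finite (SArith_bident n)"
    using bij_betw_finite[OF SArith_bident_bij[OF assms]] fin by (simp add: N_def)
  define M where "M = (N + 1) div 2"
  have M: "1 \<le> M" "real N / 2 \<le> real M" using N by (auto simp: M_def)
  have "(\<Sum>a = 1..M. (real a)\<^sup>2 + 1) = 2 + (\<Sum>a = 2..M. (real a)\<^sup>2 + 1)"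
    using M(1) by (subst sum.atLeast_Suc_atMost) (auto simp: numeral_2_eq_2)
  then have "(\<Sum>a = 2..M. (real a)\<^sup>2 + 1) = real M * (real M + 1) * (2 * real M + 1) / 6 + real M - 2"
    unfolding sum.distrib[of _ _ "{1..M}"] sum_squares_closed by simp
  moreover have "real (\<Sum>a = 2..M. a\<^sup>2 + 1) \<le> real (card (sum_prod_pairs N))"
    using sum_prod_pairs_lower[OF fin] by (simp only: M_def of_nat_le_iff)
  moreover have "real (\<Sum>a = 2..M. a\<^sup>2 + 1) = (\<Sum>a = 2..M. (real a)\<^sup>2 + 1)"
    by (simp add: add.commute)
  \<comment> \<open>Replacing \<open>M\<close> by the smaller \<open>N / 2\<close> treats both
    parities of \<open>N\<close> at once.\<close>
  moreover have "real N / 2 * (real N / 2 + 1) * (2 * (real N / 2) + 1) \<le> real M * (real M + 1) * (2 * real M + 1)"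
    using M by (intro mult_mono add_mono) auto
  ultimately have low: "real N / 2 * (real N / 2 + 1) * (2 * (real N / 2) + 1) / 6 + real N / 2 - 2
      \<le> real (card (sum_prod_pairs N))"
    using M by linarith
  have "1 / 24 * (real n ^ 3 - 3 * real n ^ 2 - real n - 45) \<le> real (card (SArith_bident n))"
  proof -
    \<comment> \<open>The bound obtained exceeds the claimed one by
      \<open>(15 * N + 3) / 24\<close>.\<close>
    have "1 / 24 * (real n ^ 3 - 3 * real n ^ 2 - real n - 45)
        = real N / 2 * (real N / 2 + 1) * (2 * (real N / 2) + 1) / 6 + real N / 2 - 2 - (15 * real N + 3) / 24"
      unfolding N(2) by (simp add: field_simps power2_eq_square power3_eq_cube)
    moreover have "0 \<le> (15 * real N + 3) / 24" by simp
    ultimately show ?thesis unfolding card using low by linarith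
  qed
  moreover have "real (card (SArith_bident n)) <
      2 / 3 * real n ^ 3 - 2 * real n ^ 2 + 16 / 3 * real n - 6
        + (2 * real n ^ 2 - 4 * real n + 2) * ln (real n - 3)"
  proof -
    have ln: "ln (real n - 3) = ln (real N - 1)" "0 \<le> ln (real N - 1)" using N by auto
    have "2 * (real N)\<^sup>2 * ln (real N - 1) \<le> 2 * (real N + 1)\<^sup>2 * ln (real N - 1)"
      using ln by (intro mult_right_mono mult_left_mono power_mono) auto
    moreover have "2 * real n ^ 2 - 4 * real n + 2 = 2 * (real N + 1)\<^sup>2"
      unfolding N(2) by (simp add: field_simps power2_eq_square)
    \<comment> \<open>The spare \<open>2 * N + 4\<close> makes the inequality strict; the logarithm
      cannot do so at \<open>N = 2\<close>, where it vanishes.\<close>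
    moreover have "real N * (real N + 1) * (2 * real N + 1) / 3 - 2 + 2 * (real N)\<^sup>2 + 2 * real N
        - real N * (real N + 1) + 2 * real N + (2 * real N + 4)
        = 2 / 3 * real n ^ 3 - 2 * real n ^ 2 + 16 / 3 * real n - 6"
      unfolding N(2) by (simp add: field_simps power2_eq_square power3_eq_cube)
    ultimately show ?thesis
      using sum_prod_pairs_upper(2)[OF N(1)] card ln(1) by (simp add: distrib_left)
  qed
  ultimately show ?thesis using finS by blast
qed

end
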